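(* (a) Let $X$ be a non-empty set. The quadruple $(\mathcal{P}(X),\circ,/\ \backslash,j_X)$ is the free operated monoid on $X$. In particular, $(\mathcal{P},\circ,/\ \backslash)$ is the free operated monoid on one generator. (b) Let $X$ be a non-empty set. The quadruple $(\mathcal{L}(X),\circ,/\ \backslash,j_X)$ is the free operated semigroup on $X$. In particular, $(\mathcal{L},\circ,/\ \backslash)$ is the free operated semigroup on one generator. (c) The triple $(\mathcal{D},\circ,/\ \backslash)$ is the free operated monoid on the empty set.
   Context: **Operated semigroups and monoids.** An operated semigroup (resp. monoid) is a semigroup (resp. monoid) $U$ together with a map of sets $\alpha:U\to U$ (no compatibility with the product is required). A morphism $(U,\alpha)\to(V,\beta)$ is a semigroup (resp. monoid) homomorphism $f$ with $f\circ\alpha=\beta\circ f$. The free operated semigroup (resp. monoid) on a set $Y$ is an operated semigroup (resp. monoid) $U_Y$ with a map $j_Y:Y\to U_Y$ such that for every operated semigroup (resp. monoid) $V$ and map $f:Y\to V$ there is a unique morphism $\bar f:U_Y\to V$ with $f=\bar f\circ j_Y$; when $Y=\emptyset$ the map $j_Y$ is dropped. **Motzkin paths.** A Motzkin path is a lattice path in $\mathbb{N}^2$ (with $\mathbb{N}$ the non-negative integers) from $(0,0)$ to some $(n,0)$, $n\ge 0$, with steps $(1,1)$ (up), $(1,-1)$ (down) and $(1,0)$ (level). The trivial path (a single point) is denoted $\bullet$. $\mathcal{P}$ is the set of Motzkin paths. The link product $\mathfrak{m}\circ\mathfrak{m}'$ joins the last vertex of $\mathfrak{m}$ with the first vertex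 of $\mathfrak{m}'$. The raising operator sends $\mathfrak{m}$ to $/\,\mathfrak{m}\,\backslash$, obtained by adding an up step at the left end and a down step at the right end. A path is peak-free if it is not $\bullet$ and has no up step immediately followed by a down step; $\mathcal{L}\subseteq\mathcal{P}$ is the set of peak-free Motzkin paths. A Dyck path is a Motzkin path with no level steps (including $\bullet$); $\mathcal{D}\subseteq\mathcal{P}$ is the set of Dyck paths. For a set $X$, an $X$-decorated Motzkin path is a Motzkin path whose level steps are decorated by elements of $X$; $\mathcal{P}(X)$ is the set of these and $\mathcal{L}(X)$ is the subset of peak-free ones, with link product and raising operator defined in the same way. Undecorated Motzkin paths are identified with $X$-decorated ones for $X$ a singleton. The map $j_X$ sends $x\in X$ to the path consisting of a single level step decorated by $x$; in the undecorated cases the generator is the single level step. *)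

theory Defs
  imports "HOL-Algebra.Group" "HOL-Library.Product_Plus"
begin

section \<open>Operated semigroups and monoids\<close>

text \<open>HOL-Algebra has no carrier-based semigroups, so these get a record of their own.\<close>

record 'a operated_semigroup = "'a partial_object" +
  smult :: "'a \<Rightarrow> 'a \<Rightarrow> 'a"
  soper :: "'a \<Rightarrow> 'a"

locale operated_semigroup =
  fixes U :: "'a operated_semigroup"
  assumes smult_closed:
      "\<lbrakk>x \<in> carrier U; y \<in> carrier U\<rbrakk> \<Longrightarrow> smult U x y \<in> carrier U"
    and smult_assoc:
      "\<lbrakk>x \<in> carrier U; y \<in> carrier U; z \<in> carrier U\<rbrakk>
       \<Longrightarrow> smult U (smult U x y) z = smult U x (smult U y z)"
    and soper_closed: "x \<in> carrier U \<Longrightarrow> soper U x \<in> carrier U"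

record 'a operated_monoid = "'a monoid" +
  oper :: "'a \<Rightarrow> 'a"

locale operated_monoid = monoid U for U :: "'a operated_monoid" +
  assumes oper_closed: "x \<in> carrier U \<Longrightarrow> oper U x \<in> carrier U"

definition operated_semigroup_hom ::
    "'a operated_semigroup \<Rightarrow> 'b operated_semigroup \<Rightarrow> ('a \<Rightarrow> 'b) set" where
  "operated_semigroup_hom U V =
    {h. h \<in> carrier U \<rightarrow> carrier V \<and>
        (\<forall>x \<in> carrier U. \<forall>y \<in> carrier U. h (smult U x y) = smult V (h x) (h y)) \<and>
        (\<forall>x \<in> carrier U. h (soper U x) = soper V (h x))}"

text \<open>The library's \<^const>\<open>hom\<close> does not ask for preservation of the unit.\<close>

definition operated_monoid_hom ::
    "'a operated_monoid \<Rightarrow> 'b operated_monoid \<Rightarrow> ('a \<Rightarrow> 'b) set" where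
  "operated_monoid_hom U V =
    {h \<in> hom U V. h (one U) = one V \<and> (\<forall>x \<in> carrier U. h (oper U x) = oper V (h x))}"

text \<open>
  HOL cannot quantify over types inside a formula, so the type that carries the test objects
  \<open>V\<close> is a parameter of the notion of freeness. A theorem polymorphic in that parameter has
  the universal property for operated semigroups (monoids) over every type. Morphisms are taken
  to be extensional so that uniqueness concerns only their values on the carrier.
\<close>

definition free_operated_semigroup ::
    "'v itself \<Rightarrow> 'a operated_semigroup \<Rightarrow> 'y set \<Rightarrow> ('y \<Rightarrow> 'a) \<Rightarrow> bool" where
  "free_operated_semigroup _ U Y j \<longleftrightarrow>
    operated_semigroup U \<and> j \<in> Y \<rightarrow> carrier U \<and>
    (\<forall>V :: 'v operated_semigroup. operated_semigroup V \<longrightarrow>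
      (\<forall>f \<in> Y \<rightarrow> carrier V.
        \<exists>!h. h \<in> extensional (carrier U) \<and> h \<in> operated_semigroup_hom U V \<and>
             (\<forall>y \<in> Y. h (j y) = f y)))"

definition free_operated_monoid ::
    "'v itself \<Rightarrow> 'a operated_monoid \<Rightarrow> 'y set \<Rightarrow> ('y \<Rightarrow> 'a) \<Rightarrow> bool" where
  "free_operated_monoid _ U Y j \<longleftrightarrow>
    operated_monoid U \<and> j \<in> Y \<rightarrow> carrier U \<and>
    (\<forall>V :: 'v operated_monoid. operated_monoid V \<longrightarrow>
      (\<forall>f \<in> Y \<rightarrow> carrier V.
        \<exists>!h. h \<in> extensional (carrier U) \<and> h \<in> operated_monoid_hom U V \<and>
             (\<forall>y \<in> Y. h (j y) = f y)))"

section \<open>Motzkin paths\<close>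

datatype 'x step = Up | Down | Level 'x

fun step_vector :: "'x step \<Rightarrow> int \<times> int" where
  "step_vector Up = (1, 1)"
| "step_vector Down = (1, -1)"
| "step_vector (Level x) = (1, 0)"

text \<open>
  A path starting at the origin is encoded by its list of steps, the trivial path by \<open>[]\<close>;
  \<open>vertex p k\<close> is the vertex reached after \<open>k\<close> steps.
\<close>

definition vertex :: "'x step list \<Rightarrow> nat \<Rightarrow> int \<times> int" where
  "vertex p k = (\<Sum>s\<leftarrow>take k p. step_vector s)"

definition motzkin_paths :: "'x set \<Rightarrow> 'x step list set" where
  "motzkin_paths X =
    {p. (\<forall>x. Level x \<in> set p \<longrightarrow> x \<in> X) \<and>
        (\<forall>k \<le> length p. 0 \<le> fst (vertex p k) \<and> 0 \<le> snd (vertex p k)) \<and>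
        (\<exists>n :: nat. vertex p (length p) = (int n, 0))}"

definition peak_free :: "'x step list \<Rightarrow> bool" where
  "peak_free p \<longleftrightarrow>
    p \<noteq> [] \<and> \<not> (\<exists>i. Suc i < length p \<and> p ! i = Up \<and> p ! Suc i = Down)"

definition peak_free_motzkin_paths :: "'x set \<Rightarrow> 'x step list set" where
  "peak_free_motzkin_paths X = {p \<in> motzkin_paths X. peak_free p}"

text \<open>Undecorated paths are the paths decorated by the singleton \<open>{()}\<close>.\<close>

definition dyck_paths :: "unit step list set" where
  "dyck_paths = {p \<in> motzkin_paths {()}. \<forall>x. Level x \<notin> set p}"

text \<open>
  Steps are translation invariant, so joining the last vertex of one path with the first vertex
  of another is concatenation of step lists.
\<close>

definition link :: "'x step list \<Rightarrow> 'x step list \<Rightarrow> 'x step list" where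
  "link p q = p @ q"

definition raise_path :: "'x step list \<Rightarrow> 'x step list" where
  "raise_path p = [Up] @ p @ [Down]"

definition level_path :: "'x \<Rightarrow> 'x step list" where
  "level_path x = [Level x]"

definition motzkin_monoid :: "'x set \<Rightarrow> 'x step list operated_monoid" where
  "motzkin_monoid X =
    \<lparr>carrier = motzkin_paths X, mult = link, one = [], oper = raise_path\<rparr>"

definition peak_free_motzkin_semigroup :: "'x set \<Rightarrow> 'x step list operated_semigroup" where
  "peak_free_motzkin_semigroup X =
    \<lparr>carrier = peak_free_motzkin_paths X, smult = link, soper = raise_path\<rparr>"

definition dyck_monoid :: "unit step list operated_monoid" where
  "dyck_monoid = \<lparr>carrier = dyck_paths, mult = link, one = [], oper = raise_path\<rparr>"

end

theory Submission
  imports Defs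
begin

text \<open>
  The three freeness claims rest on two facts about the raising operator and the link product.

  \<^item> Generation: cutting a path at its first return to the axis shows that every Motzkin path is
    obtained from level steps by linking and raising, and that a peak-free path is so obtained
    without ever using the trivial path (\<open>motzkin_induct\<close>, \<open>peak_free_motzkin_induct\<close>). A morphism
    is therefore determined by its values on the level steps.

  \<^item> Unambiguity: different ways of building one path must yield the same value in the target.
    The extension of \<open>f\<close> is for this reason defined from the bare list of steps, by a stack machine.
    The stack holds one partial product for each up step that is still unmatched, and one for the
    ground level: an up step opens a new empty product, a level step multiplies the topmost product
    by the value of its decoration, and a down step closes the topmost product, applies the
    operator to it and multiplies the result into the product below. On a Motzkin path the net effect
    is to multiply the topmost product by a single element (\<open>run_motzkin\<close>), and the
    morphism laws can be read off from that.

  An operated semigroup \<open>V\<close> has no empty product, so a unit is adjoined to it and the machine is run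
  in the resulting operated monoid; on a peak-free path the machine never applies the operator to
  the empty product, and so its result lies in \<open>V\<close>. Dyck paths are the Motzkin paths decorated by
  the empty set, so they need no argument of their own.
\<close>

section \<open>Paths in terms of heights\<close>

definition height :: "'x step list \<Rightarrow> int" where
  "height p = (\<Sum>s\<leftarrow>p. snd (step_vector s))"

lemma height_simps [simp]:
  "height [] = 0"
  "height (s # p) = snd (step_vector s) + height p"
  "height (p @ q) = height p + height q"
  by (simp_all add: height_def)

lemma sum_list_step_vector: "(\<Sum>s\<leftarrow>p. step_vector s) = (int (length p), height p)"
proof (induction p)
  case (Cons s p)
  then show ?case by (cases s) simp_all
qed (simp add: zero_prod_def)

text \<open>
  Every step moves one unit to the right, so only heights constrain a path. Ranging over prefixes
  instead of over indices makes the constraint compatible with concatenation.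
\<close>

lemma motzkin_paths_iff:
  "p \<in> motzkin_paths X \<longleftrightarrow>
    (\<forall>x. Level x \<in> set p \<longrightarrow> x \<in> X) \<and> (\<forall>a b. p = a @ b \<longrightarrow> 0 \<le> height a) \<and> height p = 0"
proof -
  have "(\<forall>k \<le> length p. 0 \<le> height (take k p)) \<longleftrightarrow> (\<forall>a b. p = a @ b \<longrightarrow> 0 \<le> height a)"
  proof safe
    fix a b assume "\<forall>k \<le> length (a @ b). 0 \<le> height (take k (a @ b))"
    from this[rule_format, of "length a"] show "0 \<le> height a" by simp
  next
    fix k assume "\<forall>a b. p = a @ b \<longrightarrow> 0 \<le> height a"
    then show "0 \<le> height (take k p)" by (metis append_take_drop_id)
  qed
  then show ?thesis
    by (auto simp: motzkin_paths_def vertex_def sum_list_step_vector)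
qed

lemma motzkin_Nil: "[] \<in> motzkin_paths X"
  by (simp add: motzkin_paths_iff)

lemma motzkin_level: "x \<in> X \<Longrightarrow> level_path x \<in> motzkin_paths X"
  by (auto simp: motzkin_paths_iff level_path_def Cons_eq_append_conv)

lemma motzkin_link:
  assumes "p \<in> motzkin_paths X" "q \<in> motzkin_paths X"
  shows "link p q \<in> motzkin_paths X"
  using assms by (auto simp: motzkin_paths_iff link_def append_eq_append_conv2)

lemma motzkin_raise:
  assumes "p \<in> motzkin_paths X"
  shows "raise_path p \<in> motzkin_paths X"
proof -
  have "0 \<le> height a" if ab: "Up # p @ [Down] = a @ b" for a b
  proof (cases a)
    case (Cons s a')
    with ab have a': "s = Up" "p @ [Down] = a' @ b" by auto
    show ?thesis
    proof (cases b rule: rev_cases)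
      case Nil
      with a' have "height a' = height p - 1" by auto
      with assms Cons a' show ?thesis by (simp add: motzkin_paths_iff)
    next
      case (snoc b' t)
      with a' assms have "0 \<le> height a'" by (auto simp: motzkin_paths_iff)
      with Cons a' show ?thesis by simp
    qed
  qed simp
  with assms show ?thesis by (auto simp: motzkin_paths_iff raise_path_def)
qed

section \<open>Generation by level steps\<close>

text \<open>
  This finds the partner of an up step: applied to the steps after it, \<open>Down\<close> is the first step to
  descend below their starting height, and \<open>m\<close> is what the matching pair encloses. The
  height \<open>c\<close> at the start is arbitrary because it changes as the induction consumes steps.
\<close>

lemma first_descent_below_axis:
  assumes "0 \<le> c" "c + height p < 0"
  shows "\<exists>m q. p = m @ Down # q \<and> c + height m = 0 \<and> (\<forall>a b. m = a @ b \<longrightarrow> 0 \<le> c + height a)"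
  using assms
proof (induction p arbitrary: c)
  case (Cons s p)
  show ?case
  proof (cases "c + snd (step_vector s) < 0")
    case True
    with Cons.prems(1) have "s = Down" "c = 0" by (cases s; simp)+
    then show ?thesis by (intro exI[of _ "[]"] exI[of _ p]) simp
  next
    case False
    with Cons.IH[of "c + snd (step_vector s)"] Cons.prems(2)
    obtain m q where m: "p = m @ Down # q" "c + snd (step_vector s) + height m = 0"
      "\<And>a b. m = a @ b \<Longrightarrow> 0 \<le> c + snd (step_vector s) + height a"
      by (auto simp: algebra_simps)
    have "0 \<le> c + height a" if "s # m = a @ b" for a b
      using that m(3) Cons.prems(1) by (auto simp: Cons_eq_append_conv add.assoc)
    with m show ?thesis by (intro exI[of _ "s # m"] exI[of _ q]) auto
  qed
qed simp

text \<open>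
  The decomposition at the first return to the axis: either the first step is level and is itself
  the part before that return, or it is an up step and is matched with the down step that returns.
\<close>

lemma motzkin_cases:
  assumes p: "p \<in> motzkin_paths X"
  obtains (trivial) "p = []"
  | (level) x q where "p = link (level_path x) q" "x \<in> X" "q \<in> motzkin_paths X"
  | (raise) m q where "p = link (raise_path m) q" "m \<in> motzkin_paths X" "q \<in> motzkin_paths X"
proof (cases p)
  case Nil
  then show ?thesis by (rule trivial)
next
  case (Cons s r)
  show ?thesis
  proof (cases s)
    case (Level x)
    have "0 \<le> height a" if "r = a @ b" for a b
    proof -
      have "p = (s # a) @ b" using that Cons by simp
      with p have "0 \<le> height (s # a)" unfolding motzkin_paths_iff by blast
      then show ?thesis using Level by simp
    qed
    then have "r \<in> motzkin_paths X" "x \<in> X"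
      using p Cons Level by (auto simp: motzkin_paths_iff)
    with Cons Level show ?thesis by (intro level[of x r]) (auto simp: link_def level_path_def)
  next
    case Down
    have "p = [Down] @ r" using Cons Down by simp
    with p have "0 \<le> height [Down :: 'a step]" unfolding motzkin_paths_iff by blast
    then show ?thesis by simp
  next
    case Up
    from p Cons Up have "0 + height r < 0" by (simp add: motzkin_paths_iff)
    from first_descent_below_axis[OF order.refl this]
    obtain m q where r: "r = m @ Down # q" and m: "height m = 0"
      "\<forall>a b. m = a @ b \<longrightarrow> 0 \<le> height a" by auto
    have "0 \<le> height a" if "q = a @ b" for a b
    proof -
      have "p = (Up # m @ Down # a) @ b" using that Cons Up r by simp
      with p have "0 \<le> height (Up # m @ Down # a)" unfolding motzkin_paths_iff by blast
      then show ?thesis using m by simp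
    qed
    then have "m \<in> motzkin_paths X" "q \<in> motzkin_paths X"
      using p Cons Up r m by (auto simp: motzkin_paths_iff)
    with Cons Up r show ?thesis by (intro raise[of m q]) (auto simp: link_def raise_path_def)
  qed
qed

lemma motzkin_induct [consumes 1, case_names trivial level link raise]:
  assumes "p \<in> motzkin_paths X"
    and trivial: "P []"
    and level: "\<And>x. x \<in> X \<Longrightarrow> P (level_path x)"
    and link: "\<And>p q. \<lbrakk>p \<in> motzkin_paths X; q \<in> motzkin_paths X; P p; P q\<rbrakk> \<Longrightarrow> P (link p q)"
    and raise: "\<And>p. \<lbrakk>p \<in> motzkin_paths X; P p\<rbrakk> \<Longrightarrow> P (raise_path p)"
  shows "P p"
  using assms(1)
proof (induction p rule: length_induct)
  case (1 p)
  from 1(2) show ?case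
  proof (cases rule: motzkin_cases)
    case trivial
    then show ?thesis using assms(2) by simp
  next
    case (level x q)
    then have "P q" using 1(1) by (simp add: link_def level_path_def)
    with level assms(3) show ?thesis by (simp add: link motzkin_level)
  next
    case (raise m q)
    then have "P m" "P q" using 1(1) by (simp_all add: link_def raise_path_def)
    with raise assms(5) show ?thesis by (simp add: link motzkin_raise)
  qed
qed

section \<open>Peak-free paths\<close>

lemma peak_free_iff_successively:
  "peak_free p \<longleftrightarrow> p \<noteq> [] \<and> successively (\<lambda>s t. \<not> (s = Up \<and> t = Down)) p"
  by (auto simp: peak_free_def successively_conv_nth)

lemma hd_motzkin_neq_Down:
  assumes "p \<in> motzkin_paths X" "p \<noteq> []"
  shows "hd p \<noteq> Down"
proof
  assume "hd p = Down"
  with assms(2) have "p = [Down] @ tl p" by (cases p) auto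
  with assms(1) have "0 \<le> height [Down :: 'a step]" unfolding motzkin_paths_iff by blast
  then show False by simp
qed

lemma last_motzkin_neq_Up:
  assumes "p \<in> motzkin_paths X" "p \<noteq> []"
  shows "last p \<noteq> Up"
proof
  assume "last p = Up"
  with assms(2) have p: "p = butlast p @ [Up]" by (metis append_butlast_last_id)
  with assms(1) have "0 \<le> height (butlast p)" unfolding motzkin_paths_iff by blast
  moreover have "height (butlast p) + 1 = height p" by (subst (2) p) simp
  ultimately show False using assms(1) by (simp add: motzkin_paths_iff)
qed

lemma peak_free_motzkin_level: "x \<in> X \<Longrightarrow> level_path x \<in> peak_free_motzkin_paths X"
  by (simp add: peak_free_motzkin_paths_def motzkin_level peak_free_iff_successively)
    (simp add: level_path_def)

text \<open>
  Linking creates no peak because a Motzkin path never begins with a down step, and raising creates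
  none because it never ends with an up step either and the trivial path is excluded.
\<close>

lemma peak_free_motzkin_link:
  assumes "p \<in> peak_free_motzkin_paths X" "q \<in> peak_free_motzkin_paths X"
  shows "link p q \<in> peak_free_motzkin_paths X"
  using assms hd_motzkin_neq_Down[of q X]
  by (simp add: peak_free_motzkin_paths_def motzkin_link peak_free_iff_successively)
    (simp add: link_def successively_append_iff)

lemma peak_free_motzkin_raise:
  assumes "p \<in> peak_free_motzkin_paths X"
  shows "raise_path p \<in> peak_free_motzkin_paths X"
  using assms hd_motzkin_neq_Down[of p X] last_motzkin_neq_Up[of p X]
  by (simp add: peak_free_motzkin_paths_def motzkin_raise peak_free_iff_successively)
    (simp add: raise_path_def successively_append_iff successively_Cons)

text \<open>
  In a peak-free path no pair of matching steps encloses the trivial path, so the decomposition at the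
  first return only has to avoid a trivial remainder to stay among peak-free paths.
\<close>

lemma peak_free_motzkin_induct [consumes 1, case_names level link raise]:
  assumes "p \<in> peak_free_motzkin_paths X"
    and level: "\<And>x. x \<in> X \<Longrightarrow> P (level_path x)"
    and link: "\<And>p q. \<lbrakk>p \<in> peak_free_motzkin_paths X; q \<in> peak_free_motzkin_paths X; P p; P q\<rbrakk>
      \<Longrightarrow> P (link p q)"
    and raise: "\<And>p. \<lbrakk>p \<in> peak_free_motzkin_paths X; P p\<rbrakk> \<Longrightarrow> P (raise_path p)"
  shows "P p"
  using assms(1)
proof (induction p rule: length_induct)
  case (1 p)
  then have p: "p \<in> motzkin_paths X" "peak_free p" by (auto simp: peak_free_motzkin_paths_def)
  have prepend: "P p" if "p = link u q" "q \<in> motzkin_paths X" "length q < length p"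
    and u: "u \<in> peak_free_motzkin_paths X" "P u" for u q
  proof (cases "q = []")
    case True
    with that show ?thesis by (simp add: link_def)
  next
    case False
    with that p have "q \<in> peak_free_motzkin_paths X"
      by (simp add: peak_free_motzkin_paths_def peak_free_iff_successively link_def
          successively_append_iff)
    with that 1(1) show ?thesis by (auto intro: link)
  qed
  from p(1) show ?case
  proof (cases rule: motzkin_cases)
    case trivial
    with p show ?thesis by (simp add: peak_free_def)
  next
    case (level x q)
    then have "length q < length p" by (simp add: link_def level_path_def)
    from prepend[OF level(1,3) this peak_free_motzkin_level[OF level(2)] assms(2)[OF level(2)]]
    show ?thesis .
  next
    case (raise m q)
    then have less: "length m < length p" "length q < length p"
      by (simp_all add: link_def raise_path_def)
    have "successively (\<lambda>s t. \<not> (s = Up \<and> t = Down)) (raise_path m)"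
      using p(2) unfolding raise(1) peak_free_iff_successively link_def successively_append_iff
      by blast
    then have "m \<noteq> []" "successively (\<lambda>s t. \<not> (s = Up \<and> t = Down)) m"
      by (auto simp: raise_path_def successively_append_iff successively_Cons)
    with raise have m: "m \<in> peak_free_motzkin_paths X"
      by (simp add: peak_free_motzkin_paths_def peak_free_iff_successively)
    with less 1(1) have "P m" by blast
    from prepend[OF raise(1,3) less(2) peak_free_motzkin_raise[OF m] assms(4)[OF m this]]
    show ?thesis .
  qed
qed

section \<open>Evaluation by a stack machine\<close>

text \<open>
  The last equation makes the machine ignore a step for which the stack is too short; this does not
  happen on Motzkin paths.
\<close>

fun exec_step ::
    "'v operated_monoid \<Rightarrow> ('x \<Rightarrow> 'v) \<Rightarrow> 'x step \<Rightarrow> 'v list \<Rightarrow> 'v list" where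
  "exec_step V f Up st = one V # st"
| "exec_step V f (Level x) (v # st) = (v \<otimes>\<^bsub>V\<^esub> f x) # st"
| "exec_step V f Down (u # v # st) = (v \<otimes>\<^bsub>V\<^esub> oper V u) # st"
| "exec_step V f s st = st"

definition run ::
    "'v operated_monoid \<Rightarrow> ('x \<Rightarrow> 'v) \<Rightarrow> 'x step list \<Rightarrow> 'v list \<Rightarrow> 'v list" where
  "run V f = fold (exec_step V f)"

definition path_value :: "'v operated_monoid \<Rightarrow> ('x \<Rightarrow> 'v) \<Rightarrow> 'x step list \<Rightarrow> 'v" where
  "path_value V f p = hd (run V f p [one V])"

text \<open>
  A Motzkin path returns to its starting height and stays above it, so it never reads below the
  top of the stack, and by associativity its contributions combine to a single right factor.
\<close>

lemma ex_run_motzkin: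
  assumes "operated_monoid V" and f: "f \<in> X \<rightarrow> carrier V" and "p \<in> motzkin_paths X"
  shows "\<exists>w \<in> carrier V. \<forall>v \<in> carrier V. \<forall>st. run V f p (v # st) = (v \<otimes>\<^bsub>V\<^esub> w) # st"
proof -
  interpret operated_monoid V by fact
  from assms(3) show ?thesis
  proof (induction rule: motzkin_induct)
    case trivial
    show ?case by (intro bexI[of _ "one V"]) (auto simp: run_def)
  next
    case (level x)
    with f show ?case by (intro bexI[of _ "f x"]) (auto simp: run_def level_path_def)
  next
    case (link p q)
    from link.IH obtain w w' where w: "w \<in> carrier V" "w' \<in> carrier V"
      "\<And>v st. v \<in> carrier V \<Longrightarrow> run V f p (v # st) = (v \<otimes>\<^bsub>V\<^esub> w) # st"
      "\<And>v st. v \<in> carrier V \<Longrightarrow> run V f q (v # st) = (v \<otimes>\<^bsub>V\<^esub> w') # st"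
      by blast
    have "run V f (link p q) (v # st) = (v \<otimes>\<^bsub>V\<^esub> (w \<otimes>\<^bsub>V\<^esub> w')) # st" if "v \<in> carrier V" for v st
    proof -
      have "run V f (link p q) (v # st) = run V f q (run V f p (v # st))"
        by (simp add: run_def link_def)
      with that w show ?thesis by (simp add: m_assoc)
    qed
    with w show ?case by (intro bexI[of _ "w \<otimes>\<^bsub>V\<^esub> w'"]) auto
  next
    case (raise p)
    from raise.IH obtain w where w: "w \<in> carrier V"
      "\<And>v st. v \<in> carrier V \<Longrightarrow> run V f p (v # st) = (v \<otimes>\<^bsub>V\<^esub> w) # st"
      by blast
    have "run V f (raise_path p) (v # st) = (v \<otimes>\<^bsub>V\<^esub> oper V w) # st" for v st
    proof -
      have "run V f (raise_path p) (v # st) = exec_step V f Down (run V f p (one V # v # st))"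
        by (simp add: run_def raise_path_def)
      with w show ?thesis by simp
    qed
    with w show ?case by (intro bexI[of _ "oper V w"]) (auto intro: oper_closed)
  qed
qed

lemma run_motzkin:
  assumes "operated_monoid V" "f \<in> X \<rightarrow> carrier V" "p \<in> motzkin_paths X"
  shows "path_value V f p \<in> carrier V"
    and "v \<in> carrier V \<Longrightarrow> run V f p (v # st) = (v \<otimes>\<^bsub>V\<^esub> path_value V f p) # st"
proof -
  interpret operated_monoid V by fact
  obtain w where w: "w \<in> carrier V"
      "\<And>v st. v \<in> carrier V \<Longrightarrow> run V f p (v # st) = (v \<otimes>\<^bsub>V\<^esub> w) # st"
    using ex_run_motzkin[OF assms] by blast
  then have "path_value V f p = w" by (simp add: path_value_def)
  with w show "path_value V f p \<in> carrier V"
    and "v \<in> carrier V \<Longrightarrow> run V f p (v # st) = (v \<otimes>\<^bsub>V\<^esub> path_value V f p) # st"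
    by simp_all
qed

lemma path_value_Nil: "path_value V f [] = one V"
  by (simp add: path_value_def run_def)

lemma path_value_level:
  assumes "operated_monoid V" "f \<in> X \<rightarrow> carrier V" "x \<in> X"
  shows "path_value V f (level_path x) = f x"
proof -
  interpret operated_monoid V by fact
  have "f x \<in> carrier V" using assms(2,3) by auto
  then show ?thesis by (simp add: path_value_def run_def level_path_def)
qed

lemma path_value_link:
  assumes "operated_monoid V" "f \<in> X \<rightarrow> carrier V" "p \<in> motzkin_paths X" "q \<in> motzkin_paths X"
  shows "path_value V f (link p q) = path_value V f p \<otimes>\<^bsub>V\<^esub> path_value V f q"
proof -
  interpret operated_monoid V by fact
  have "path_value V f (link p q) = hd (run V f q (run V f p [one V]))"
    by (simp add: path_value_def run_def link_def)
  then show ?thesis using run_motzkin[OF assms(1,2,3)] run_motzkin[OF assms(1,2,4)] by simp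
qed

lemma path_value_raise:
  assumes "operated_monoid V" "f \<in> X \<rightarrow> carrier V" "p \<in> motzkin_paths X"
  shows "path_value V f (raise_path p) = oper V (path_value V f p)"
proof -
  interpret operated_monoid V by fact
  have "path_value V f (raise_path p) = hd (exec_step V f Down (run V f p [one V, one V]))"
    by (simp add: path_value_def run_def raise_path_def)
  then show ?thesis using run_motzkin[OF assms] by (simp add: oper_closed)
qed

section \<open>Freeness of the monoid of Motzkin paths\<close>

lemma operated_monoid_motzkin: "operated_monoid (motzkin_monoid X)"
  by unfold_locales
    (auto simp: motzkin_monoid_def motzkin_Nil motzkin_link motzkin_raise, auto simp: link_def)

theorem free_operated_monoid_motzkin:
  "free_operated_monoid TYPE('v) (motzkin_monoid X) X level_path"
  unfolding free_operated_monoid_def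
proof (intro conjI allI impI ballI)
  show "operated_monoid (motzkin_monoid X)" by (rule operated_monoid_motzkin)
  show "level_path \<in> X \<rightarrow> carrier (motzkin_monoid X)"
    by (simp add: motzkin_monoid_def motzkin_level)
next
  fix V :: "'v operated_monoid" and f
  assume V: "operated_monoid V" and f: "f \<in> X \<rightarrow> carrier V"
  show "\<exists>!h. h \<in> extensional (carrier (motzkin_monoid X)) \<and>
      h \<in> operated_monoid_hom (motzkin_monoid X) V \<and> (\<forall>y \<in> X. h (level_path y) = f y)"
  proof (rule ex1I; (elim conjE)?)
    let ?h = "restrict (path_value V f) (motzkin_paths X)"
    show "?h \<in> extensional (carrier (motzkin_monoid X)) \<and>
        ?h \<in> operated_monoid_hom (motzkin_monoid X) V \<and> (\<forall>y \<in> X. ?h (level_path y) = f y)"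
      using run_motzkin(1)[OF V f] path_value_level[OF V f] path_value_link[OF V f]
        path_value_raise[OF V f]
      by (simp add: motzkin_monoid_def operated_monoid_hom_def hom_def motzkin_Nil motzkin_level
          motzkin_link motzkin_raise path_value_Nil)
  next
    fix h assume ext: "h \<in> extensional (carrier (motzkin_monoid X))"
      and hom: "h \<in> operated_monoid_hom (motzkin_monoid X) V"
      and gen: "\<forall>y \<in> X. h (level_path y) = f y"
    have "h p = path_value V f p" if "p \<in> motzkin_paths X" for p
      using that
    proof (induction rule: motzkin_induct)
      case trivial
      show ?case
        using hom by (simp add: path_value_Nil operated_monoid_hom_def motzkin_monoid_def)
    next
      case (level x)
      then show ?case using gen path_value_level[OF V f] by simp
    next
      case (link p q)
      then show ?case using hom path_value_link[OF V f, of p q]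
        by (simp add: operated_monoid_hom_def hom_def motzkin_monoid_def)
    next
      case (raise p)
      then show ?case using hom path_value_raise[OF V f, of p]
        by (simp add: operated_monoid_hom_def motzkin_monoid_def)
    qed
    with ext show "h = restrict (path_value V f) (motzkin_paths X)"
      by (intro extensionalityI[of _ "motzkin_paths X"]) (simp_all add: motzkin_monoid_def)
  qed
qed

section \<open>Freeness of the semigroup of peak-free paths\<close>

text \<open>
  \<open>None\<close> is the new unit. The operator has to be given some value at it, and any value would do:
  peak-free paths never raise the trivial path.
\<close>

definition adjoin_unit :: "'v operated_semigroup \<Rightarrow> 'v option operated_monoid" where
  "adjoin_unit V =
    \<lparr>carrier = insert None (Some ` carrier V),
     mult = (\<lambda>a b. case a of None \<Rightarrow> b
       | Some u \<Rightarrow> (case b of None \<Rightarrow> a | Some v \<Rightarrow> Some (smult V u v))),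
     one = None,
     oper = map_option (soper V)\<rparr>"

lemma operated_monoid_adjoin_unit:
  assumes "operated_semigroup V"
  shows "operated_monoid (adjoin_unit V)"
proof -
  interpret operated_semigroup V by fact
  show ?thesis
    by unfold_locales (auto simp: adjoin_unit_def smult_closed smult_assoc soper_closed)
qed

lemma operated_semigroup_peak_free: "operated_semigroup (peak_free_motzkin_semigroup X)"
  by unfold_locales
    (auto simp: peak_free_motzkin_semigroup_def peak_free_motzkin_link peak_free_motzkin_raise,
      auto simp: link_def)

theorem free_operated_semigroup_peak_free:
  "free_operated_semigroup TYPE('v) (peak_free_motzkin_semigroup X) X level_path"
  unfolding free_operated_semigroup_def
proof (intro conjI allI impI ballI)
  show "operated_semigroup (peak_free_motzkin_semigroup X)"
    by (rule operated_semigroup_peak_free)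
  show "level_path \<in> X \<rightarrow> carrier (peak_free_motzkin_semigroup X)"
    by (simp add: peak_free_motzkin_semigroup_def peak_free_motzkin_level)
next
  fix V :: "'v operated_semigroup" and f
  assume sg: "operated_semigroup V" and f: "f \<in> X \<rightarrow> carrier V"
  interpret operated_semigroup V by (rule sg)
  let ?L = "peak_free_motzkin_paths X" and ?W = "adjoin_unit V"
  have W: "operated_monoid ?W" by (rule operated_monoid_adjoin_unit[OF sg])
  have g: "(\<lambda>x. Some (f x)) \<in> X \<rightarrow> carrier ?W" using f by (auto simp: adjoin_unit_def)
  let ?e = "path_value ?W (\<lambda>x. Some (f x))"
  let ?h = "restrict (\<lambda>p. the (?e p)) ?L"
  have motzkin: "p \<in> motzkin_paths X" if "p \<in> ?L" for p
    using that by (simp add: peak_free_motzkin_paths_def)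
  note e_level = path_value_level[OF W g] and e_link = path_value_link[OF W g motzkin motzkin]
    and e_raise = path_value_raise[OF W g motzkin]
  have e: "?e p \<in> Some ` carrier V" if "p \<in> ?L" for p
    using that
  proof (induction rule: peak_free_motzkin_induct)
    case (level x)
    then show ?case using e_level f by auto
  next
    case (link p q)
    then show ?case using e_link[of p q] smult_closed by (auto simp: adjoin_unit_def)
  next
    case (raise p)
    then show ?case using e_raise[of p] soper_closed by (auto simp: adjoin_unit_def)
  qed
  have the_link: "the (?e (link p q)) = smult V (the (?e p)) (the (?e q))" if "p \<in> ?L" "q \<in> ?L" for p q
    using e[OF that(1)] e[OF that(2)] e_link[OF that] by (auto simp: adjoin_unit_def)
  have the_raise: "the (?e (raise_path p)) = soper V (the (?e p))" if "p \<in> ?L" for p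
    using e[OF that] e_raise[OF that] by (auto simp: adjoin_unit_def)
  show "\<exists>!h. h \<in> extensional (carrier (peak_free_motzkin_semigroup X)) \<and>
      h \<in> operated_semigroup_hom (peak_free_motzkin_semigroup X) V \<and>
      (\<forall>y \<in> X. h (level_path y) = f y)"
  proof (rule ex1I[of _ ?h]; (elim conjE)?)
    have "the (?e p) \<in> carrier V" if "p \<in> ?L" for p
      using e[OF that] by auto
    then show "?h \<in> extensional (carrier (peak_free_motzkin_semigroup X)) \<and>
        ?h \<in> operated_semigroup_hom (peak_free_motzkin_semigroup X) V \<and>
        (\<forall>y \<in> X. ?h (level_path y) = f y)"
      using the_link the_raise e_level
      by (simp add: peak_free_motzkin_semigroup_def operated_semigroup_hom_def
          peak_free_motzkin_level peak_free_motzkin_link peak_free_motzkin_raise)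
  next
    fix h assume ext: "h \<in> extensional (carrier (peak_free_motzkin_semigroup X))"
      and hom: "h \<in> operated_semigroup_hom (peak_free_motzkin_semigroup X) V"
      and gen: "\<forall>y \<in> X. h (level_path y) = f y"
    have "h p = the (?e p)" if "p \<in> ?L" for p
      using that
    proof (induction rule: peak_free_motzkin_induct)
      case (level x)
      then show ?case using gen e_level by simp
    next
      case (link p q)
      then show ?case using hom the_link[of p q]
        by (simp add: operated_semigroup_hom_def peak_free_motzkin_semigroup_def)
    next
      case (raise p)
      then show ?case using hom the_raise[of p]
        by (simp add: operated_semigroup_hom_def peak_free_motzkin_semigroup_def)
    qed
    with ext show "h = ?h"
      by (intro extensionalityI[of _ ?L]) (simp_all add: peak_free_motzkin_semigroup_def)
  qed
qed

section \<open>Dyck paths and the three freeness statements\<close>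

lemma dyck_monoid_eq_motzkin_monoid: "dyck_monoid = motzkin_monoid {}"
  by (auto simp: dyck_monoid_def motzkin_monoid_def dyck_paths_def motzkin_paths_iff)

theorem corollary2p2:
  fixes X :: "'x set" and j :: "'y \<Rightarrow> unit step list"
  shows "(X \<noteq> {} \<longrightarrow> free_operated_monoid TYPE('v) (motzkin_monoid X) X level_path)
    \<and> free_operated_monoid TYPE('v) (motzkin_monoid {()}) {()} level_path
    \<and> (X \<noteq> {} \<longrightarrow> free_operated_semigroup TYPE('v) (peak_free_motzkin_semigroup X) X level_path)
    \<and> free_operated_semigroup TYPE('v) (peak_free_motzkin_semigroup {()}) {()} level_path
    \<and> free_operated_monoid TYPE('v) dyck_monoid ({} :: 'y set) j"
proof -
  have "free_operated_monoid TYPE('v) dyck_monoid ({} :: 'y set) j"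
    using free_operated_monoid_motzkin[of "{} :: unit set", where 'v = 'v]
    by (simp add: free_operated_monoid_def dyck_monoid_eq_motzkin_monoid)
  then show ?thesis
    by (simp add: free_operated_monoid_motzkin free_operated_semigroup_peak_free)
qed

end
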